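(* For $a>0$, $b>0$ and every integer $n\ge 0$ put $$A_n(a,b)=\left(\frac{(-1)^n\left(\psi^{(n)}(b+a)-\psi^{(n)}(b)\right)}{n!}\right)^{\frac{1}{n+1}}.$$ Then for any $b>0$ and any $0<a_1<1<a_2$, the following hold for every integer $n\ge 0$: $$A_n(a_1,b)<A_{n+1}(a_1,b)<\frac1b\qquad\text{and}\qquad A_n(a_2,b)>A_{n+1}(a_2,b)>\frac1b .$$ That is, $$\psi^{(0)}(b+a_1)-\psi^{(0)}(b)=A_0(a_1,b)<A_1(a_1,b)<\dots<A_n(a_1,b)<\dots<\frac1b,$$ $$\psi^{(0)}(b+a_2)-\psi^{(0)}(b)=A_0(a_2,b)>A_1(a_2,b)>\dots>A_n(a_2,b)>\dots>\frac1b.$$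
   Context: For an integer $m\ge 0$, $\psi^{(m)}$ denotes the polygamma function of order $m$ on $(0,+\infty)$, i.e. the derivative of order $m+1$ of $\ln\Gamma$, where $\Gamma$ is the gamma function. The quantity inside the $(n+1)$-th root is positive for all $a,b>0$ and $n\ge 0$. *)

theory Defs
  imports "HOL-Analysis.Analysis"
begin

text \<open>The library's \<^const>\<open>Polygamma\<close> is defined by a series; on the positive reals it is the
  iterated derivative of \<open>ln \<Gamma>\<close>:\<close>

lemma Polygamma_eq_higher_deriv_ln_Gamma:
  fixes x :: real
  assumes "x > 0"
  shows "Polygamma m x = (deriv ^^ (m + 1)) (\<lambda>t. ln (Gamma t)) x"
proof -
  have "eventually (\<lambda>t. t \<in> {0<..}) (nhds x)"
    using assms by (intro eventually_nhds_in_open) auto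
  then have "eventually (\<lambda>t. ln (Gamma t) = ln_Gamma t) (nhds x)"
    by eventually_elim (simp add: ln_Gamma_real_pos)
  then have "(deriv ^^ (m + 1)) (\<lambda>t. ln (Gamma t)) x = (deriv ^^ (m + 1)) ln_Gamma x"
    by (intro higher_deriv_cong_ev refl)
  also have "\<dots> = Polygamma m x"
    using assms by (subst higher_deriv_ln_Gamma_real) auto
  finally show ?thesis by simp
qed

text \<open>The radicand is positive whenever \<open>a, b > 0\<close>, which is the only case of interest.\<close>

definition A :: "nat \<Rightarrow> real \<Rightarrow> real \<Rightarrow> real" where
  "A n a b = root (n + 1) ((-1) ^ n * (Polygamma n (b + a) - Polygamma n b) / fact n)"

end

theory Submission
  imports Defs
begin

text \<open>In the integral representation, \<open>(b A\<^sub>n)\<^sup>n\<^sup>+\<^sup>1\<close> is the mean of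
  \<open>(1 - exp (-a t)) / (1 - exp (-t))\<close> under a Gamma distribution with parameters \<open>n + 1, b\<close>, and this
  function of \<open>t\<close> is monotone with limit \<open>1\<close>; so these means are monotone in \<open>n\<close> and on one side of \<open>1\<close>,
  and passing to roots only helps. The integral is avoided by a difference argument: monotonicity
  of the means says that some function \<open>D\<close> of \<open>b\<close> has constant sign. \<open>D\<close> and its first difference
  tend to \<open>0\<close> at infinity, while its second difference is an explicit combination of three powers
  whose sign is given by strict convexity.\<close>

section \<open>Normalized polygamma functions and their shift recurrence\<close>

text \<open>Sign and factorial are chosen so that every order is increasing on the positive reals
  and the shift by 1 adds exactly \<open>1 / x ^ (n + 1)\<close>.\<close>

definition npolygamma :: "nat \<Rightarrow> real \<Rightarrow> real" where
  "npolygamma n x = (-1) ^ n * Polygamma n x / fact n"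

definition npolygamma_diff :: "nat \<Rightarrow> real \<Rightarrow> real \<Rightarrow> real" where
  "npolygamma_diff n a x = npolygamma n (x + a) - npolygamma n x"

lemma npolygamma_plus1:
  assumes "x > 0"
  shows "npolygamma n (x + 1) = npolygamma n x + 1 / x ^ (n + 1)"
proof -
  have "(-1) ^ n * (-1) ^ n = (1::real)"
    by (simp flip: power_mult_distrib)
  then show ?thesis
    using assms unfolding npolygamma_def
    by (subst Polygamma_plus1) (auto simp: ring_distribs add_divide_distrib mult.assoc[symmetric])
qed

lemma npolygamma_strict_mono:
  assumes "0 < x" "x < y"
  shows "npolygamma n x < npolygamma n y"
proof (cases "even n")
  case True
  then show ?thesis
    using Polygamma_real_strict_mono[OF assms True]
    by (simp add: npolygamma_def divide_strict_right_mono)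
next
  case False
  then show ?thesis
    using Polygamma_real_strict_antimono[OF assms False]
    by (simp add: npolygamma_def divide_strict_right_mono)
qed

text \<open>The recurrence telescopes, and each of the \<open>N\<close> increments is at most the
  first one. With \<open>N\<close> an upper bound of a real shift \<open>a\<close>, this yields
  decay at infinity.\<close>

lemma npolygamma_plus_of_nat_le:
  assumes "x > 0"
  shows "npolygamma n (x + of_nat N) \<le> npolygamma n x + of_nat N / x ^ (n + 1)"
proof (induction N)
  case (Suc N)
  have "1 / (x + of_nat N) ^ (n + 1) \<le> 1 / x ^ (n + 1)"
    using assms by (intro divide_left_mono power_mono mult_pos_pos zero_less_power) auto
  then show ?case
    using Suc npolygamma_plus1[of "x + of_nat N" n] assms
    by (simp add: add_divide_distrib algebra_simps)
qed simp

lemma npolygamma_diff_pos: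
  assumes "a > 0" "x > 0"
  shows "npolygamma_diff n a x > 0"
  using npolygamma_strict_mono[of x "x + a" n] assms by (simp add: npolygamma_diff_def)

lemma npolygamma_diff_strict_mono:
  assumes "0 < a" "a < a'" "x > 0"
  shows "npolygamma_diff n a x < npolygamma_diff n a' x"
  using npolygamma_strict_mono[of "x + a" "x + a'" n] assms by (simp add: npolygamma_diff_def)

text \<open>The explicit case against which other values of \<open>a\<close> are compared; it is the
  source of the bound \<open>1 / b\<close>.\<close>

lemma npolygamma_diff_1:
  assumes "x > 0"
  shows "npolygamma_diff n 1 x = 1 / x ^ (n + 1)"
  using npolygamma_plus1[OF assms] by (simp add: npolygamma_diff_def)

lemma npolygamma_diff_plus1:
  assumes "a > 0" "x > 0"
  shows "npolygamma_diff n a (x + 1) =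
           npolygamma_diff n a x + 1 / (x + a) ^ (n + 1) - 1 / x ^ (n + 1)"
  using npolygamma_plus1[of x n] npolygamma_plus1[of "x + a" n] assms
  by (simp add: npolygamma_diff_def add_ac)

section \<open>Decay at infinity and signs read off from differences\<close>

lemma npolygamma_diff_le:
  assumes "a > 0" "x > 0"
  shows "npolygamma_diff n a x \<le> of_nat (nat \<lceil>a\<rceil>) / x ^ (n + 1)"
proof -
  have "x + a \<le> x + of_nat (nat \<lceil>a\<rceil>)" by linarith
  then have "npolygamma n (x + a) \<le> npolygamma n (x + of_nat (nat \<lceil>a\<rceil>))"
    using npolygamma_strict_mono[of "x + a" _ n] assms by (metis add_pos_pos less_eq_real_def)
  then show ?thesis
    using npolygamma_plus_of_nat_le[of x n "nat \<lceil>a\<rceil>"] assms by (simp add: npolygamma_diff_def)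
qed

lemma tendsto_const_div_power_at_top: "((\<lambda>x::real. c / x ^ (n + 1)) \<longlongrightarrow> 0) at_top"
  by (intro real_tendsto_divide_at_top[OF tendsto_const] filterlim_pow_at_top filterlim_ident) simp

lemma npolygamma_diff_tendsto_0:
  assumes "a > 0"
  shows "(npolygamma_diff n a \<longlongrightarrow> 0) at_top"
proof (rule tendsto_sandwich[OF _ _ tendsto_const tendsto_const_div_power_at_top])
  show "\<forall>\<^sub>F x in at_top. 0 \<le> npolygamma_diff n a x"
    using eventually_gt_at_top[of 0]
    by eventually_elim (use npolygamma_diff_pos assms in \<open>auto intro: less_imp_le\<close>)
  show "\<forall>\<^sub>F x in at_top. npolygamma_diff n a x \<le> of_nat (nat \<lceil>a\<rceil>) / x ^ (n + 1)"
    using eventually_gt_at_top[of 0]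
    by eventually_elim (use npolygamma_diff_le assms in auto)
qed

lemma times_npolygamma_diff_tendsto_0:
  assumes "a > 0"
  shows "((\<lambda>x. x * npolygamma_diff (n + 1) a x) \<longlongrightarrow> 0) at_top"
proof (rule tendsto_sandwich[OF _ _ tendsto_const tendsto_const_div_power_at_top])
  show "\<forall>\<^sub>F x in at_top. 0 \<le> x * npolygamma_diff (n + 1) a x"
    using eventually_gt_at_top[of 0]
    by eventually_elim (use npolygamma_diff_pos assms in \<open>auto intro: less_imp_le\<close>)
  show "\<forall>\<^sub>F x in at_top. x * npolygamma_diff (n + 1) a x \<le> of_nat (nat \<lceil>a\<rceil>) / x ^ (n + 1)"
    using eventually_gt_at_top[of 0]
  proof eventually_elim
    case (elim x)
    have "x * npolygamma_diff (n + 1) a x \<le> x * (of_nat (nat \<lceil>a\<rceil>) / x ^ (n + 1 + 1))"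
      using npolygamma_diff_le[OF assms, of x "n + 1"] elim by (intro mult_left_mono) auto
    also have "\<dots> = of_nat (nat \<lceil>a\<rceil>) / x ^ (n + 1)"
      using elim by simp
    finally show ?case .
  qed
qed

lemma pos_if_strict_decreasing_tendsto_0:
  fixes f :: "real \<Rightarrow> real"
  assumes dec: "\<And>x. x > 0 \<Longrightarrow> f (x + 1) < f x"
    and lim: "(f \<longlongrightarrow> 0) at_top" and "x > 0"
  shows "f x > 0"
proof -
  \<comment> \<open>Starting at \<open>x + 1\<close> gives only \<open>f (x + 1) \<ge> 0\<close>,
    but keeps the strict step from \<open>x\<close> to \<open>x + 1\<close> in reserve.\<close>
  have "decseq (\<lambda>k. f (x + 1 + of_nat k))"
  proof (rule decseq_SucI)
    fix k show "f (x + 1 + of_nat (Suc k)) \<le> f (x + 1 + of_nat k)"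
      using dec[of "x + 1 + of_nat k"] \<open>x > 0\<close> by (simp add: add_ac)
  qed
  moreover have "(\<lambda>k. f (x + 1 + of_nat k)) \<longlonglongrightarrow> 0"
    by (rule filterlim_compose[OF lim])
       (intro filterlim_tendsto_add_at_top[OF tendsto_const] filterlim_real_sequentially)
  ultimately have "f (x + 1 + of_nat 0) \<ge> 0"
    by (rule decseq_ge)
  with dec[OF \<open>x > 0\<close>] show ?thesis by simp
qed

section \<open>Strict convexity of negative powers\<close>

text \<open>Bernoulli's inequality for \<open>(y / x) ^ m\<close>, divided by \<open>y ^ m\<close>.
  Bernoulli can be an equality (\<open>m = 1\<close>), so strictness comes from first replacing
  \<open>y / x - 1\<close> by the smaller \<open>(y - x) / y\<close>, which also makes the bound
  linear in \<open>x\<close>.\<close>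

lemma inverse_power_above_tangent:
  fixes x y :: real
  assumes "x > 0" "y > 0" "x \<noteq> y" "m > 0"
  shows "1 / y ^ m + of_nat m * (y - x) / y ^ (m + 1) < 1 / x ^ m"
proof -
  have "(y - x) / y < y / x - 1"
  proof -
    have "(y / x - 1) - (y - x) / y = (y - x)\<^sup>2 / (x * y)"
      using assms by (simp add: field_simps power2_eq_square)
    moreover have "\<dots> > 0" using assms by simp
    ultimately show ?thesis by linarith
  qed
  then have "1 + of_nat m * ((y - x) / y) < 1 + of_nat m * (y / x - 1)"
    using assms by (intro add_strict_left_mono mult_strict_left_mono) auto
  also have "\<dots> \<le> (1 + (y / x - 1)) ^ m"
    using assms by (intro Bernoulli_inequality) auto
  also have "\<dots> = y ^ m / x ^ m"
    by (simp add: power_divide)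
  finally have "(1 + of_nat m * ((y - x) / y)) / y ^ m < (y ^ m / x ^ m) / y ^ m"
    using assms by (intro divide_strict_right_mono) auto
  then show ?thesis
    using assms by (simp add: add_divide_distrib mult.commute)
qed

text \<open>Add the tangent bounds at the barycenter \<open>y\<close>: the linear terms cancel. The
  weights are not normalized, so \<open>a > 1\<close> needs no division.\<close>

lemma inverse_power_strict_convex:
  fixes x y z p q :: real
  assumes "x > 0" "y > 0" "z > 0" "p > 0" "q > 0" "m > 0"
    and bary: "p * x + q * z = (p + q) * y" and "x \<noteq> y"
  shows "(p + q) / y ^ m < p / x ^ m + q / z ^ m"
proof -
  define d where "d = of_nat m / y ^ (m + 1)"
  have tangent: "1 / y ^ m + d * (y - w) < 1 / w ^ m" if "w > 0" "w \<noteq> y" for w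
    using inverse_power_above_tangent[of w y m] that assms by (simp add: d_def)
  have "z \<noteq> y"
    using bary assms by (auto simp: algebra_simps)
  have "(p + q) / y ^ m = p * (1 / y ^ m + d * (y - x)) + q * (1 / y ^ m + d * (y - z))"
  proof -
    have "p * (d * (y - x)) + q * (d * (y - z)) = d * ((p + q) * y - (p * x + q * z))"
      by (simp add: algebra_simps)
    then have "p * (d * (y - x)) + q * (d * (y - z)) = 0"
      using bary by simp
    then show ?thesis
      by (simp add: distrib_left add_divide_distrib)
  qed
  also have "\<dots> < p * (1 / x ^ m) + q * (1 / z ^ m)"
    using assms \<open>z \<noteq> y\<close> by (intro add_strict_mono mult_strict_left_mono tangent) auto
  finally show ?thesis by simp
qed

section \<open>The sign of the step from order \<open>n\<close> to \<open>n + 1\<close>\<close>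

text \<open>The factor \<open>x\<close> in \<open>D\<close> matches the increments of the two
  orders, so differencing once removes order \<open>n\<close>; differencing again removes order
  \<open>n + 1\<close> and leaves only powers.\<close>

lemma npolygamma_diff_step_second_difference:
  fixes a x :: real and n :: nat
  assumes "a > 0" "x > 0"
  defines "D \<equiv> \<lambda>x. x * npolygamma_diff (n + 1) a x - npolygamma_diff n a x"
  defines "E \<equiv> \<lambda>x. a / (x + a) ^ (n + 2) - npolygamma_diff (n + 1) a (x + 1)"
  shows "D x - D (x + 1) = E x"
    and "E x - E (x + 1) =
           a / (x + a) ^ (n + 2) + (1 - a) / (x + 1 + a) ^ (n + 2) - 1 / (x + 1) ^ (n + 2)"
proof -
  \<comment> \<open>The increments at order \<open>n + 1\<close>; those at order \<open>n\<close>
    are \<open>x * u\<close> and \<open>(x + a) * v\<close>, so the identity becomes linear in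
    \<open>u\<close> and \<open>v\<close>.\<close>
  define u v where "u = 1 / x ^ (n + 2)" and "v = 1 / (x + a) ^ (n + 2)"
  have "npolygamma_diff n a (x + 1) = npolygamma_diff n a x + (x + a) * v - x * u"
    using npolygamma_diff_plus1[of a x n] assms by (simp add: u_def v_def)
  moreover have "npolygamma_diff (n + 1) a (x + 1) = npolygamma_diff (n + 1) a x + v - u"
    using npolygamma_diff_plus1[of a x "n + 1"] assms by (simp add: u_def v_def)
  moreover have "E x = a * v - npolygamma_diff (n + 1) a (x + 1)"
    by (simp add: E_def v_def)
  ultimately show "D x - D (x + 1) = E x"
    unfolding D_def by (simp only:) (simp (no_asm) add: algebra_simps)
  show "E x - E (x + 1) =
          a / (x + a) ^ (n + 2) + (1 - a) / (x + 1 + a) ^ (n + 2) - 1 / (x + 1) ^ (n + 2)"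
    using npolygamma_diff_plus1[of a "x + 1" "n + 1"] assms
    by (simp add: E_def diff_divide_distrib)
qed

text \<open>The sign \<open>s\<close> treats \<open>a < 1\<close> and \<open>a > 1\<close> simultaneously.\<close>

lemma npolygamma_diff_step_sign:
  fixes a s x :: real
  assumes a: "a > 0" and "x > 0"
    and second: "\<And>x. x > 0 \<Longrightarrow>
      0 < s * (a / (x + a) ^ (n + 2) + (1 - a) / (x + 1 + a) ^ (n + 2) - 1 / (x + 1) ^ (n + 2))"
  shows "0 < s * (x * npolygamma_diff (n + 1) a x - npolygamma_diff n a x)"
proof -
  define D where "D = (\<lambda>x. x * npolygamma_diff (n + 1) a x - npolygamma_diff n a x)"
  define E where "E = (\<lambda>x. a / (x + a) ^ (n + 2) - npolygamma_diff (n + 1) a (x + 1))"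
  have shift: "filterlim (\<lambda>x::real. x + c) at_top at_top" for c
    by (subst add.commute) (rule filterlim_tendsto_add_at_top[OF tendsto_const filterlim_ident])
  have E_pos: "0 < s * E x" if "x > 0" for x
  proof (rule pos_if_strict_decreasing_tendsto_0[OF _ _ that])
    fix x :: real assume "x > 0"
    then have "0 < s * (E x - E (x + 1))"
      unfolding E_def npolygamma_diff_step_second_difference(2)[OF a \<open>x > 0\<close>] by (rule second)
    then show "s * E (x + 1) < s * E x" by (simp add: right_diff_distrib)
  next
    have "((\<lambda>x. s * E x) \<longlongrightarrow> s * (0 - 0)) at_top"
      unfolding E_def
      using filterlim_compose[OF tendsto_const_div_power_at_top[of a "n + 1"] shift[of a]]
        filterlim_compose[OF npolygamma_diff_tendsto_0[OF a, of "n + 1"] shift[of 1]]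
      by (intro tendsto_intros) simp_all
    then show "((\<lambda>x. s * E x) \<longlongrightarrow> 0) at_top" by simp
  qed
  have "0 < s * D x"
  proof (rule pos_if_strict_decreasing_tendsto_0[OF _ _ \<open>x > 0\<close>])
    fix x :: real assume "x > 0"
    then have "D x - D (x + 1) = E x"
      using npolygamma_diff_step_second_difference(1)[OF a, of x n] by (simp add: D_def E_def)
    then have "s * D x - s * D (x + 1) = s * E x"
      by (metis right_diff_distrib)
    then show "s * D (x + 1) < s * D x"
      using E_pos[OF \<open>x > 0\<close>] by simp
  next
    have "((\<lambda>x. s * D x) \<longlongrightarrow> s * (0 - 0)) at_top"
      unfolding D_def
      by (intro tendsto_intros npolygamma_diff_tendsto_0 times_npolygamma_diff_tendsto_0 a)
    then show "((\<lambda>x. s * D x) \<longlongrightarrow> 0) at_top" by simp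
  qed
  then show ?thesis by (simp add: D_def)
qed

lemma npolygamma_diff_less_step:
  assumes "0 < a" "a < 1" "x > 0"
  shows "npolygamma_diff n a x < x * npolygamma_diff (n + 1) a x"
proof -
  have "0 < 1 * (a / (y + a) ^ (n + 2) + (1 - a) / (y + 1 + a) ^ (n + 2) - 1 / (y + 1) ^ (n + 2))"
    if "y > 0" for y
    \<comment> \<open>Here \<open>y + 1\<close> is the mean of \<open>y + a\<close> and
      \<open>y + 1 + a\<close> with weights \<open>a\<close> and \<open>1 - a\<close>.\<close>
    using inverse_power_strict_convex[of "y + a" "y + 1" "y + 1 + a" a "1 - a" "n + 2"] assms that
    by (simp add: algebra_simps)
  from npolygamma_diff_step_sign[OF assms(1,3) this] show ?thesis by simp
qed

lemma npolygamma_diff_greater_step: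
  assumes "1 < a" "x > 0"
  shows "npolygamma_diff n a x > x * npolygamma_diff (n + 1) a x"
proof -
  have "0 < (-1) * (a / (y + a) ^ (n + 2) + (1 - a) / (y + 1 + a) ^ (n + 2) - 1 / (y + 1) ^ (n + 2))"
    if "y > 0" for y
  proof -
    \<comment> \<open>For \<open>a > 1\<close> the weight \<open>1 - a\<close> is negative; moved
      across, it makes \<open>y + a\<close> the middle point, between \<open>y + 1\<close> and
      \<open>y + 1 + a\<close>.\<close>
    have "(1 + (a - 1)) / (y + a) ^ (n + 2) < 1 / (y + 1) ^ (n + 2) + (a - 1) / (y + 1 + a) ^ (n + 2)"
      using assms that by (intro inverse_power_strict_convex) (auto simp: algebra_simps)
    then show ?thesis by (simp add: diff_divide_distrib)
  qed
  from npolygamma_diff_step_sign[OF _ assms(2) this] assms show ?thesis by simp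
qed

section \<open>Passage to roots\<close>

text \<open>Scaling by \<open>b\<close> moves the threshold \<open>1 / b\<close> to 1, where roots
  of different degrees can be compared.\<close>

lemma A_eq_root_npolygamma_diff:
  assumes "b > 0"
  shows "b * A n a b = root (n + 1) (b ^ (n + 1) * npolygamma_diff n a b)"
proof -
  have "A n a b = root (n + 1) (npolygamma_diff n a b)"
    by (simp add: A_def npolygamma_diff_def npolygamma_def right_diff_distrib diff_divide_distrib)
  moreover have "root (n + 1) (b ^ (n + 1)) = b"
    using assms by (intro real_root_power_cancel) auto
  ultimately show ?thesis
    by (simp only: real_root_mult)
qed

lemma A_strict_increasing:
  assumes "0 < a" "a < 1" "b > 0"
  shows "A n a b < A (n + 1) a b" and "A n a b < 1 / b"
proof -
  define B where "B = (\<lambda>n. b ^ (n + 1) * npolygamma_diff n a b)"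
  have B_pos: "B n > 0" for n
    using npolygamma_diff_pos assms by (simp add: B_def)
  have B_less_1: "B n < 1" for n
    using npolygamma_diff_strict_mono[OF assms, of n] npolygamma_diff_1[OF assms(3), of n] assms
    by (simp add: B_def field_simps)
  have bA: "b * A n a b = root (n + 1) (B n)" for n
    using A_eq_root_npolygamma_diff assms by (simp add: B_def)
  have "B n < B (n + 1)"
    using mult_strict_left_mono[OF npolygamma_diff_less_step[OF assms, of n], of "b ^ (n + 1)"] assms
    by (simp add: B_def mult_ac)
  then have "root (n + 1) (B n) < root (n + 1) (B (n + 1))"
    by (intro real_root_less_mono) auto
  \<comment> \<open>On (0, 1) raising the degree increases the root.\<close>
  also have "\<dots> \<le> root (n + 1 + 1) (B (n + 1))"
    using B_pos[of "n + 1"] B_less_1[of "n + 1"] by (intro real_root_increasing) auto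
  finally have "b * A n a b < b * A (n + 1) a b"
    unfolding bA .
  then show "A n a b < A (n + 1) a b"
    using assms by simp
  have "b * A n a b < 1"
    using B_less_1[of n] unfolding bA by simp
  then show "A n a b < 1 / b"
    using assms by (simp add: field_simps)
qed

lemma A_strict_decreasing:
  assumes "1 < a" "b > 0"
  shows "A n a b > A (n + 1) a b" and "A n a b > 1 / b"
proof -
  define B where "B = (\<lambda>n. b ^ (n + 1) * npolygamma_diff n a b)"
  have B_gt_1: "B n > 1" for n
    using npolygamma_diff_strict_mono[OF _ assms, of n] npolygamma_diff_1[OF assms(2), of n] assms
    by (simp add: B_def field_simps)
  have bA: "b * A n a b = root (n + 1) (B n)" for n
    using A_eq_root_npolygamma_diff assms by (simp add: B_def)
  \<comment> \<open>Above 1 raising the degree decreases the root.\<close>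
  have "root (n + 1 + 1) (B (n + 1)) \<le> root (n + 1) (B (n + 1))"
    using B_gt_1[of "n + 1"] by (intro real_root_decreasing) auto
  also have "\<dots> < root (n + 1) (B n)"
    using mult_strict_left_mono[OF npolygamma_diff_greater_step[OF assms, of n], of "b ^ (n + 1)"]
      assms by (intro real_root_less_mono) (auto simp: B_def mult_ac)
  finally have "b * A (n + 1) a b < b * A n a b"
    unfolding bA .
  then show "A n a b > A (n + 1) a b"
    using assms by simp
  have "b * A n a b > 1"
    using B_gt_1[of n] unfolding bA by simp
  then show "A n a b > 1 / b"
    using assms by (simp add: field_simps)
qed

theorem mainTheorem2:
  fixes a\<^sub>1 a\<^sub>2 b :: real
  assumes "b > 0" and "0 < a\<^sub>1" and "a\<^sub>1 < 1" and "1 < a\<^sub>2"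
  shows "(\<forall>n::nat. A n a\<^sub>1 b < A (n + 1) a\<^sub>1 b \<and> A (n + 1) a\<^sub>1 b < 1 / b
                \<and> A n a\<^sub>2 b > A (n + 1) a\<^sub>2 b \<and> A (n + 1) a\<^sub>2 b > 1 / b)
       \<and> Polygamma 0 (b + a\<^sub>1) - Polygamma 0 b = A 0 a\<^sub>1 b
       \<and> Polygamma 0 (b + a\<^sub>2) - Polygamma 0 b = A 0 a\<^sub>2 b"
  using A_strict_increasing[OF assms(2,3,1)] A_strict_decreasing[OF assms(4,1)]
  \<comment> \<open>At order 0 the root has degree 1, and sign and factorial are 1.\<close>
  by (auto simp: A_def[of 0])

end
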